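(* Let $X$ be any compact ultrametric space and let $s<\dim X$, where $\dim$ denotes Hausdorff dimension. Then there is a regular ultrametric space $Y=Y(k,q)$ of Hausdorff dimension at least $s$ and a co-Lipschitz map $\varphi:Y\to X$, i.e. a map for which there is a constant $c>0$ such that $$d(\varphi(a),\varphi(b))\ \ge\ c\cdot d(a,b)\qquad\text{for all }a,b\in Y.$$
   Context: An ultrametric space is a metric space $(X,d)$ with $d(x,z)\le\max(d(x,y),d(y,z))$ for all $x,y,z\in X$. For an integer $k\ge1$ and a real number $q>1$, the regular ultrametric space $Y(k,q)$ is the set $\{1,\dots,k\}^{\mathbb{N}}$ of infinite words $\bar x=(x_1,x_2,\dots)$ endowed with the distance $d(\bar x,\bar y)=q^{-\min\{i:\,x_i\ne y_i\}}$ for $\bar x\neq\bar y$ (and $d(\bar x,\bar x)=0$). A co-Lipschitz map is not required to be continuous. *)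

theory Defs
  imports "HOL-Analysis.Analysis"
begin

text \<open>
  Metric spaces are given by a carrier and a distance function (locale \<open>Metric_space\<close>), since the
  distance on the regular ultrametric spaces below depends on a parameter.
\<close>

locale Ultrametric_space = Metric_space +
  assumes ultrametric:
    "\<lbrakk>x \<in> M; y \<in> M; z \<in> M\<rbrakk> \<Longrightarrow> d x z \<le> max (d x y) (d y z)"

text \<open>
  The empty set has diameter 0 because the supremum is taken in the extended nonnegative reals.
\<close>

definition ediam :: "('a \<Rightarrow> 'a \<Rightarrow> real) \<Rightarrow> 'a set \<Rightarrow> ennreal" where
  "ediam d U = (SUP x\<in>U. SUP y\<in>U. ennreal (d x y))"

text \<open>
  The summand \<open>(diam U)\<^sup>t\<close> in the Hausdorff measure, for sets of finite diameter. The case distinction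
  implements the usual convention that a nonempty set contributes 1 when \<open>t = 0\<close>, even if it is a
  singleton (whereas \<open>0 powr 0 = 0\<close>), and that the empty set contributes nothing.
\<close>

definition diam_pow :: "('a \<Rightarrow> 'a \<Rightarrow> real) \<Rightarrow> real \<Rightarrow> 'a set \<Rightarrow> ennreal" where
  "diam_pow d t U =
     (if U = {} then 0 else if t = 0 then 1 else ennreal (enn2real (ediam d U) powr t))"

text \<open>Sequences of sets are general countable covers, as members may be empty.\<close>

definition hausdorff_premeasure ::
    "'a set \<Rightarrow> ('a \<Rightarrow> 'a \<Rightarrow> real) \<Rightarrow> real \<Rightarrow> real \<Rightarrow> ennreal" where
  "hausdorff_premeasure M d t \<delta> =
     (INF U \<in> {U :: nat \<Rightarrow> 'a set.
                 (\<forall>i. U i \<subseteq> M) \<and> M \<subseteq> (\<Union>i. U i) \<and> (\<forall>i. ediam d (U i) \<le> ennreal \<delta>)}.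
        \<Sum>i. diam_pow d t (U i))"

definition hausdorff_measure :: "'a set \<Rightarrow> ('a \<Rightarrow> 'a \<Rightarrow> real) \<Rightarrow> real \<Rightarrow> ennreal" where
  "hausdorff_measure M d t = (SUP \<delta>\<in>{0<..}. hausdorff_premeasure M d t \<delta>)"

text \<open>The dimension is \<open>\<infinity>\<close> if no measure vanishes (infimum of the empty set), and 0 if \<open>M\<close> is empty.\<close>

definition hausdorff_dim :: "'a set \<Rightarrow> ('a \<Rightarrow> 'a \<Rightarrow> real) \<Rightarrow> ereal" where
  "hausdorff_dim M d = (INF t \<in> {t. 0 \<le> t \<and> hausdorff_measure M d t = 0}. ereal t)"

text \<open>
  Infinite words over \<open>{1..k}\<close>. The letter \<open>x\<^sub>1\<close> is \<open>x 0\<close>, so the first position at which two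
  distinct words differ, counted from 1, is the successor of the least differing index.
\<close>

definition words :: "nat \<Rightarrow> (nat \<Rightarrow> nat) set" where
  "words k = {x. \<forall>i. x i \<in> {1..k}}"

definition word_dist :: "real \<Rightarrow> (nat \<Rightarrow> nat) \<Rightarrow> (nat \<Rightarrow> nat) \<Rightarrow> real" where
  "word_dist q x y =
     (if x = y then 0 else q powr - real (Suc (LEAST i. x i \<noteq> y i)))"

lemma Ultrametric_space_words:
  assumes "q > 1"
  shows "Ultrametric_space (words k) (word_dist q)"
proof -
  have commute: "word_dist q x y = word_dist q y x" for x y
  proof -
    have "(LEAST i. x i \<noteq> y i) = (LEAST i. y i \<noteq> x i)"
      by (rule arg_cong[of _ _ Least]) auto
    then show ?thesis by (cases "x = y") (simp_all add: word_dist_def)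
  qed
  have ultra: "word_dist q x z \<le> max (word_dist q x y) (word_dist q y z)" for x y z
  proof (cases "x = y \<or> y = z \<or> x = z")
    case True
    then show ?thesis by (auto simp: word_dist_def le_max_iff_disj)
  next
    case False
    define l where "l = (\<lambda>u v :: nat \<Rightarrow> nat. LEAST i. u i \<noteq> v i)"
    have least: "u (l u v) \<noteq> v (l u v)" if "u \<noteq> v" for u v
    proof -
      from that obtain i where "u i \<noteq> v i" by blast
      then show ?thesis unfolding l_def by (rule LeastI)
    qed
    have "min (l x y) (l y z) \<le> l x z"
    proof (rule ccontr)
      assume "\<not> min (l x y) (l y z) \<le> l x z"
      then have "l x z < l x y" "l x z < l y z" by auto
      then have "x (l x z) = y (l x z)" "y (l x z) = z (l x z)"
        using not_less_Least[of "l x z" "\<lambda>i. x i \<noteq> y i"]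
          not_less_Least[of "l x z" "\<lambda>i. y i \<noteq> z i"]
        by (auto simp: l_def)
      with least[of x z] False show False by auto
    qed
    then have "l x y \<le> l x z \<or> l y z \<le> l x z" by linarith
    then show ?thesis
      using False assms by (simp add: word_dist_def l_def le_max_iff_disj)
  qed
  have nonneg: "0 \<le> word_dist q x y" for x y
    by (simp add: word_dist_def)
  show ?thesis
  proof
    fix x y z
    show "word_dist q x z \<le> word_dist q x y + word_dist q y z"
      using ultra[of x z y] nonneg[of x y] nonneg[of y z] by linarith
    show "0 \<le> word_dist q x y" by (rule nonneg)
    show "word_dist q x y = word_dist q y x" by (rule commute)
    show "word_dist q x z \<le> max (word_dist q x y) (word_dist q y z)" by (rule ultra)
    show "word_dist q x y = 0 \<longleftrightarrow> x = y"
      using assms by (simp add: word_dist_def)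
  qed
qed

end

theory Submission
  imports Defs "HOL-Probability.Probability"
begin

text \<open>
  Let \<open>0 < s < t < dim X\<close>. The premeasure \<open>H = H\<^sup>t\<^sub>\<delta>\<close> of subsets of \<open>X\<close> is subadditive and at most \<open>r\<^sup>t\<close> on
  sets of diameter at most \<open>r \<le> \<delta>\<close>. Adding the finitely many balls of radius \<open>r\<close> one at a time
  therefore cuts a set with \<open>H \<ge> 2 m + r\<^sup>t\<close> into two parts with \<open>H \<ge> m\<close> that are unions of such balls,
  hence at distance at least \<open>r\<close> from each other. With \<open>q = 2\<^bsup>1/s\<^esup>\<close> and \<open>r\<^sub>n = r\<^sub>0 q\<^bsup>-n\<^esup>\<close>, the lower bound
  \<open>H \<ge> C r\<^sub>n\<^sup>t\<close> passes from level \<open>n\<close> to level \<open>n + 1\<close> because \<open>2 q\<^bsup>-t\<^esup> < 1\<close>. The resulting binary tree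
  of closed sets has nonempty branches by compactness, and choosing a point on each branch is
  a co-Lipschitz map on \<open>Y(2, q)\<close>. The parts are only large in premeasure: their diameters need not
  shrink, which is why the map need not be continuous.
  That \<open>Y(2, q)\<close> has dimension at least \<open>s\<close> follows from the mass distribution principle for the uniform
  product measure on words.
\<close>

section \<open>Hausdorff premeasures\<close>

lemma ediam_empty [simp]: "ediam d {} = 0"
  by (simp add: ediam_def bot_ennreal)

lemma diam_pow_empty [simp]: "diam_pow d t {} = 0"
  by (simp add: diam_pow_def)

lemma ediam_le: "ediam d U \<le> e" if "\<And>x y. x \<in> U \<Longrightarrow> y \<in> U \<Longrightarrow> ennreal (d x y) \<le> e"
  unfolding ediam_def by (intro SUP_least that)

lemma le_ediam: "ennreal (d x y) \<le> ediam d U" if "x \<in> U" "y \<in> U"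
  unfolding ediam_def using that by (meson SUP_upper2 order_refl)

lemma hausdorff_premeasure_le:
  assumes "\<And>i. U i \<subseteq> A" "A \<subseteq> (\<Union>i. U i)" "\<And>i. ediam d (U i) \<le> ennreal \<delta>"
  shows "hausdorff_premeasure A d t \<delta> \<le> (\<Sum>i. diam_pow d t (U i))"
  unfolding hausdorff_premeasure_def using assms by (intro INF_lower) auto

lemma hausdorff_premeasure_le_diam_pow:
  assumes "ediam d A \<le> ennreal \<delta>"
  shows "hausdorff_premeasure A d t \<delta> \<le> diam_pow d t A"
proof -
  let ?U = "\<lambda>i::nat. if i = 0 then A else {}"
  have "hausdorff_premeasure A d t \<delta> \<le> (\<Sum>i. diam_pow d t (?U i))"
    by (rule hausdorff_premeasure_le) (use assms in auto)
  also have "(\<Sum>i. diam_pow d t (?U i)) = (\<Sum>i\<in>{0}. diam_pow d t (?U i))"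
    by (rule suminf_finite) auto
  finally show ?thesis by simp
qed

lemma hausdorff_premeasure_empty [simp]: "hausdorff_premeasure {} d t \<delta> = 0"
  using hausdorff_premeasure_le_diam_pow[of d "{}" \<delta> t] by simp

lemma hausdorff_premeasure_le_powr:
  assumes "\<And>x y. x \<in> A \<Longrightarrow> y \<in> A \<Longrightarrow> d x y \<le> r" "0 \<le> r" "r \<le> \<delta>" "0 < t"
  shows "hausdorff_premeasure A d t \<delta> \<le> ennreal (r powr t)"
proof -
  have e: "ediam d A \<le> ennreal r"
    using assms by (intro ediam_le ennreal_leI)
  then have "enn2real (ediam d A) \<le> r"
    using assms(2) enn2real_leI by blast
  then have "diam_pow d t A \<le> ennreal (r powr t)"
    unfolding diam_pow_def using assms by (auto intro!: ennreal_leI powr_mono2)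
  moreover have "ediam d A \<le> ennreal \<delta>"
    using e assms(3) ennreal_leI order_trans by blast
  ultimately show ?thesis
    using hausdorff_premeasure_le_diam_pow order_trans by blast
qed

text \<open>The first \<open>2 * n\<close> merged terms are the first \<open>n\<close> terms of
  \<open>f\<close> and of \<open>g\<close>. This turns two covers into one sequence at no extra
  cost.\<close>

lemma suminf_interleave_le:
  fixes f g :: "nat \<Rightarrow> ennreal"
  shows "(\<Sum>i. if even i then f (i div 2) else g (i div 2)) \<le> suminf f + suminf g" (is "suminf ?h \<le> _")
proof (rule suminf_le_const)
  fix n
  have "(\<Sum>i<n. ?h i) \<le> (\<Sum>i<2 * n. ?h i)"
    by (intro sum_mono2) auto
  also have "\<dots> = (\<Sum>i<n. f i) + (\<Sum>i<n. g i)"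
    by (induction n) (auto simp: algebra_simps)
  also have "\<dots> \<le> suminf f + suminf g"
    by (intro add_mono sum_le_suminf) auto
  finally show "(\<Sum>i<n. ?h i) \<le> suminf f + suminf g" .
qed simp

lemma hausdorff_premeasure_less_cover:
  assumes "hausdorff_premeasure A d t \<delta> < c"
  obtains U where "\<And>i. U i \<subseteq> A" "A \<subseteq> (\<Union>i. U i)" "\<And>i. ediam d (U i) \<le> ennreal \<delta>"
    "(\<Sum>i. diam_pow d t (U i)) < c"
  using assms unfolding hausdorff_premeasure_def INF_less_iff by blast

text \<open>Covers of \<open>A\<close> and \<open>B\<close> within \<open>e / 2\<close> of the two
  infima interleave to a cover of the union.\<close>

lemma hausdorff_premeasure_Un:
  "hausdorff_premeasure (A \<union> B) d t \<delta> \<le> hausdorff_premeasure A d t \<delta> + hausdorff_premeasure B d t \<delta>"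
  (is "?H (A \<union> B) \<le> ?H A + ?H B")
proof (rule ennreal_le_epsilon)
  fix e :: real assume fin: "?H A + ?H B < top" and e: "0 < e"
  have "?H A < ?H A + ennreal (e / 2)" "?H B < ?H B + ennreal (e / 2)"
    using fin e by (auto simp: ennreal_add_left_cancel_less[of _ 0, simplified] less_top)
  then obtain U V where
    U: "\<And>i. U i \<subseteq> A" "A \<subseteq> (\<Union>i. U i)" "\<And>i. ediam d (U i) \<le> ennreal \<delta>"
      "(\<Sum>i. diam_pow d t (U i)) < ?H A + ennreal (e / 2)" and
    V: "\<And>i. V i \<subseteq> B" "B \<subseteq> (\<Union>i. V i)" "\<And>i. ediam d (V i) \<le> ennreal \<delta>"
      "(\<Sum>i. diam_pow d t (V i)) < ?H B + ennreal (e / 2)"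
    by (metis hausdorff_premeasure_less_cover)
  define W where "W i = (if even i then U (i div 2) else V (i div 2))" for i
  have "U i \<subseteq> W (2 * i)" "V i \<subseteq> W (2 * i + 1)" for i
    by (auto simp: W_def)
  then have "(\<Union>i. U i) \<subseteq> (\<Union>i. W i)" "(\<Union>i. V i) \<subseteq> (\<Union>i. W i)"
    by (meson SUP_least SUP_upper2 UNIV_I)+
  with U(2) V(2) have "A \<union> B \<subseteq> (\<Union>i. W i)"
    by (meson Un_least order_trans)
  moreover have "W i \<subseteq> A \<union> B" "ediam d (W i) \<le> ennreal \<delta>" for i
    using U(1,3)[of "i div 2"] V(1,3)[of "i div 2"] by (auto simp: W_def)
  ultimately have "?H (A \<union> B) \<le> (\<Sum>i. diam_pow d t (W i))"
    by (intro hausdorff_premeasure_le)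
  also have "\<dots> = (\<Sum>i. if even i then diam_pow d t (U (i div 2)) else diam_pow d t (V (i div 2)))"
    by (intro suminf_cong) (auto simp: W_def)
  also have "\<dots> \<le> (\<Sum>i. diam_pow d t (U i)) + (\<Sum>i. diam_pow d t (V i))"
    by (rule suminf_interleave_le)
  also have "\<dots> \<le> (?H A + ennreal (e / 2)) + (?H B + ennreal (e / 2))"
    using U(4) V(4) by (intro add_mono) auto
  also have "\<dots> = (?H A + ?H B) + (ennreal (e / 2) + ennreal (e / 2))"
    by (simp add: algebra_simps)
  also have "ennreal (e / 2) + ennreal (e / 2) = ennreal e"
    using e by (simp flip: ennreal_plus)
  finally show "?H (A \<union> B) \<le> ?H A + ?H B + ennreal e" .
qed

text \<open>A nonnegative exponent below the dimension has nonzero measure, and a positive supremum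
  over scales is positive at some scale. The tree is built at that fixed scale.\<close>

lemma hausdorff_premeasure_pos_if_less_dim:
  assumes "ereal t < hausdorff_dim M d" "0 \<le> t"
  obtains \<delta> where "\<delta> > 0" "hausdorff_premeasure M d t \<delta> > 0"
proof -
  have "hausdorff_measure M d t \<noteq> 0"
  proof
    assume "hausdorff_measure M d t = 0"
    then have "hausdorff_dim M d \<le> ereal t"
      unfolding hausdorff_dim_def using assms(2) by (intro INF_lower) auto
    then show False using assms(1) by simp
  qed
  then have "0 < (SUP \<delta>\<in>{0<..}. hausdorff_premeasure M d t \<delta>)"
    by (simp add: hausdorff_measure_def zero_less_iff_neq_zero)
  then obtain \<delta> where "\<delta> \<in> {0<..}" "0 < hausdorff_premeasure M d t \<delta>"
    unfolding less_SUP_iff by blast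
  with that show ?thesis by auto
qed

section \<open>Splitting saturated sets\<close>

context Ultrametric_space
begin

text \<open>For \<open>r > 0\<close> these are the unions of open balls of radius \<open>r\<close>,
  which partition the space. The closure condition names no centres, so Boolean operations are easy
  to handle.\<close>

definition saturated :: "real \<Rightarrow> 'a set \<Rightarrow> bool" where
  "saturated r A \<longleftrightarrow> A \<subseteq> M \<and> (\<forall>x\<in>A. \<forall>y\<in>M. d x y < r \<longrightarrow> y \<in> A)"

lemma saturated_mono: "saturated r A \<Longrightarrow> r' \<le> r \<Longrightarrow> saturated r' A"
  unfolding saturated_def by (meson order_less_le_trans)

lemma saturated_space: "saturated r M"
  by (simp add: saturated_def)

lemma saturated_Int: "saturated r A \<Longrightarrow> saturated r B \<Longrightarrow> saturated r (A \<inter> B)"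
  unfolding saturated_def by blast

lemma saturated_Diff: "saturated r A \<Longrightarrow> saturated r B \<Longrightarrow> saturated r (A - B)"
  unfolding saturated_def by (metis Diff_iff commute subset_iff)

lemma saturated_UN: "(\<And>i. i \<in> I \<Longrightarrow> saturated r (A i)) \<Longrightarrow> saturated r (\<Union>i\<in>I. A i)"
  unfolding saturated_def by blast

lemma saturated_mball: "saturated r (mball x r)"
  unfolding saturated_def
proof safe
  fix y z assume *: "y \<in> mball x r" "z \<in> M" "d y z < r"
  then have "d x z \<le> max (d x y) (d y z)"
    by (intro ultrametric) auto
  then show "z \<in> mball x r" using * by auto
qed auto

text \<open>The complement is saturated too, so it contains the \<open>r\<close>-ball about each of
  its points.\<close>

lemma closedin_saturated:
  assumes "saturated r A" "r > 0"
  shows "closedin mtopology A"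
proof -
  have "saturated r (M - A)"
    by (rule saturated_Diff[OF saturated_space assms(1)])
  then have "mball x r \<subseteq> M - A" if "x \<in> M - A" for x
    using that unfolding saturated_def by auto
  then have "openin mtopology (M - A)"
    using assms(2) by (auto simp: openin_mtopology)
  then show ?thesis
    using assms(1) by (simp add: closedin_def saturated_def)
qed

lemma saturated_dist:
  assumes "saturated r A" "x \<in> A" "y \<in> M" "y \<notin> A"
  shows "r \<le> d x y"
  using assms unfolding saturated_def by force

text \<open>By the ultrametric inequality a ball of radius \<open>r\<close> has diameter at most
  \<open>r\<close>, not just \<open>2 * r\<close>.\<close>

lemma premeasure_mball_le:
  assumes "0 < r" "r \<le> \<delta>" "0 < t"
  shows "hausdorff_premeasure (A \<inter> mball x r) d t \<delta> \<le> ennreal (r powr t)"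
proof (rule hausdorff_premeasure_le_powr)
  fix y z assume "y \<in> A \<inter> mball x r" "z \<in> A \<inter> mball x r"
  then show "d y z \<le> r"
    using ultrametric[of y x z] commute[of y x] by auto
qed (use assms in auto)

text \<open>A discrete intermediate value argument: each ball adds at most \<open>r powr t\<close>,
  so the first union to reach \<open>m\<close> overshoots by no more than that.\<close>

lemma exists_union_of_balls_premeasure_between:
  assumes "finite K" "0 < r" "r \<le> \<delta>" "0 < t"
    and "m \<le> hausdorff_premeasure (A \<inter> (\<Union>x\<in>K. mball x r)) d t \<delta>"
  shows "\<exists>L\<subseteq>K. m \<le> hausdorff_premeasure (A \<inter> (\<Union>x\<in>L. mball x r)) d t \<delta> \<and>
    hausdorff_premeasure (A \<inter> (\<Union>x\<in>L. mball x r)) d t \<delta> \<le> m + ennreal (r powr t)"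
  using assms(1,5)
proof (induction K rule: finite_induct)
  case empty
  then show ?case by auto
next
  case (insert x F)
  let ?H = "\<lambda>L. hausdorff_premeasure (A \<inter> (\<Union>x\<in>L. mball x r)) d t \<delta>"
  show ?case
  proof (cases "m \<le> ?H F")
    case True
    with insert.IH show ?thesis by blast
  next
    case False
    have "A \<inter> (\<Union>x\<in>insert x F. mball x r) = (A \<inter> (\<Union>x\<in>F. mball x r)) \<union> (A \<inter> mball x r)"
      by auto
    then have "?H (insert x F) \<le> ?H F + hausdorff_premeasure (A \<inter> mball x r) d t \<delta>"
      by (simp only: hausdorff_premeasure_Un)
    also have "\<dots> \<le> m + ennreal (r powr t)"
      using False premeasure_mball_le[OF assms(2-4)] by (intro add_mono) auto
    finally show ?thesis using insert.prems by blast
  qed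
qed

lemma saturated_split:
  assumes "compact_space mtopology" "0 < r" "r \<le> \<delta>" "0 < t" "0 \<le> m"
    and sat: "saturated r A"
    and large: "ennreal (2 * m + r powr t) \<le> hausdorff_premeasure A d t \<delta>"
  shows "\<exists>B\<subseteq>A. saturated r B \<and> saturated r (A - B) \<and>
    ennreal m \<le> hausdorff_premeasure B d t \<delta> \<and> ennreal m \<le> hausdorff_premeasure (A - B) d t \<delta>"
proof -
  let ?H = "\<lambda>A. hausdorff_premeasure A d t \<delta>"
  have "mtotally_bounded M"
    using assms(1) compactin_imp_mtotally_bounded by (simp add: compact_space_def)
  then obtain K where K: "finite K" "M \<subseteq> (\<Union>x\<in>K. mball x r)"
    unfolding mtotally_bounded_def using assms(2) by blast
  have "A \<subseteq> M" using sat by (simp add: saturated_def)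
  then have "A \<inter> (\<Union>x\<in>K. mball x r) = A" using K(2) by blast
  moreover have "ennreal m \<le> ennreal (2 * m + r powr t)"
    using assms(5) by (intro ennreal_leI) simp
  ultimately have "ennreal m \<le> ?H (A \<inter> (\<Union>x\<in>K. mball x r))"
    using large by simp
  from exists_union_of_balls_premeasure_between[OF K(1) assms(2-4) this]
  obtain L where L: "ennreal m \<le> ?H (A \<inter> (\<Union>x\<in>L. mball x r))"
    "?H (A \<inter> (\<Union>x\<in>L. mball x r)) \<le> ennreal m + ennreal (r powr t)"
    by blast
  define B where "B = A \<inter> (\<Union>x\<in>L. mball x r)"
  have satB: "saturated r B"
    unfolding B_def by (intro saturated_Int sat saturated_UN saturated_mball)
  have "B \<union> (A - B) = A" by (auto simp: B_def)
  \<comment> \<open>The part \<open>B\<close> takes at most \<open>m + r powr t\<close>.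
    Subadditivity and cancellation of this finite amount leave at least \<open>m\<close> for
    \<open>A - B\<close>.\<close>
  have "ennreal (m + r powr t) + ennreal m = ennreal (2 * m + r powr t)"
    using assms(5) by (simp flip: ennreal_plus add: algebra_simps)
  also note large
  also have "?H A \<le> ?H B + ?H (A - B)"
    using hausdorff_premeasure_Un[of B "A - B" d t \<delta>] \<open>B \<union> (A - B) = A\<close> by simp
  also have "\<dots> \<le> ennreal (m + r powr t) + ?H (A - B)"
    using L(2) assms(5) by (intro add_mono) (auto simp: B_def)
  finally have "ennreal m \<le> ?H (A - B)"
    by (simp add: ennreal_add_left_cancel_le)
  moreover have "B \<subseteq> A" by (auto simp: B_def)
  ultimately show ?thesis
    using satB saturated_Diff[OF sat satB] L(1) by (auto simp: B_def)
qed

end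

section \<open>The binary tree\<close>

text \<open>The function \<open>\<beta> n\<close> picks one part of a set at level \<open>n\<close>.
  Letter 1 follows that part and any other letter its complement, so siblings are disjoint.\<close>

primrec branch :: "(nat \<Rightarrow> 'a set \<Rightarrow> 'a set) \<Rightarrow> 'a set \<Rightarrow> (nat \<Rightarrow> nat) \<Rightarrow> nat \<Rightarrow> 'a set" where
  "branch \<beta> A w 0 = A"
| "branch \<beta> A w (Suc n) =
     (if w n = 1 then \<beta> n (branch \<beta> A w n) else branch \<beta> A w n - \<beta> n (branch \<beta> A w n))"

lemma branch_cong: "(\<And>i. i < n \<Longrightarrow> v i = w i) \<Longrightarrow> branch \<beta> A v n = branch \<beta> A w n"
  by (induction n) auto

context Ultrametric_space
begin

lemma exists_co_lipschitz_from_binary_words: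
  assumes comp: "compact_space mtopology"
    and q: "1 < q" "2 < q powr t" and t: "0 < t"
    and \<delta>: "0 < \<delta>" "0 < hausdorff_premeasure M d t \<delta>"
  shows "\<exists>\<phi> \<in> words 2 \<rightarrow> M. \<exists>c>0. \<forall>a\<in>words 2. \<forall>b\<in>words 2. c * word_dist q a b \<le> d (\<phi> a) (\<phi> b)"
proof -
  let ?H = "\<lambda>A. hausdorff_premeasure A d t \<delta>"
  \<comment> \<open>This \<open>C\<close> solves \<open>(2 * C + 1) / q powr t = C\<close>, so
    \<open>C * r n powr t\<close> pays exactly for two parts at the next level and one ball.\<close>
  define C where "C = 1 / (q powr t - 2)"
  have C: "0 < C" using q by (simp add: C_def)
  obtain h where h: "0 < h" "ennreal h \<le> ?H M"
  proof (cases "?H M")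
    case (real h)
    then show ?thesis using \<delta>(2) that[of h] by auto
  next
    case top
    then show ?thesis using that[of 1] by auto
  qed
  \<comment> \<open>The minimum keeps every radius at most \<open>\<delta>\<close> and gives
    \<open>C * r 0 powr t \<le> h\<close>, which makes the whole space a valid root.\<close>
  define r where "r n = min \<delta> ((h / C) powr (1 / t)) / q ^ n" for n
  have r_pos: "0 < r n" for n
    using \<delta>(1) h(1) C q(1) by (simp add: r_def)
  have r_Suc: "r (Suc n) = r n / q" for n
    by (simp add: r_def)
  have r_mono: "r (Suc n) \<le> r n" for n
    using r_pos[of n] q(1) by (simp add: r_Suc field_simps)
  have r_0: "r 0 \<le> \<delta>" "r 0 \<le> (h / C) powr (1 / t)"
    by (simp_all add: r_def)
  have r_le: "r n \<le> \<delta>" for n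
    by (induction n) (use r_0 r_mono order_trans in blast)+
  have step: "2 * (C * r (Suc n) powr t) + r (Suc n) powr t = C * r n powr t" for n
  proof -
    have "r (Suc n) powr t = r n powr t / q powr t"
      using r_pos[of n] q(1) by (simp add: r_Suc powr_divide)
    moreover have "(2 * C + 1) / q powr t = C"
      using q by (simp add: C_def divide_simps)
    ultimately show ?thesis
      by (metis distrib_right mult.assoc mult.left_neutral times_divide_eq_left times_divide_eq_right)
  qed

  define P where "P n A \<longleftrightarrow> saturated (r n) A \<and> ennreal (C * r n powr t) \<le> ?H A" for n A
  \<comment> \<open>The implication stands under the quantifier so that \<open>\<beta>\<close> can
    be chosen for all \<open>n\<close> and \<open>A\<close> at once.\<close>
  have "\<exists>B. P n A \<longrightarrow> B \<subseteq> A \<and> P (Suc n) B \<and> P (Suc n) (A - B)" for n A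
  proof (cases "P n A")
    case True
    have "\<exists>B\<subseteq>A. saturated (r (Suc n)) B \<and> saturated (r (Suc n)) (A - B) \<and>
      ennreal (C * r (Suc n) powr t) \<le> ?H B \<and> ennreal (C * r (Suc n) powr t) \<le> ?H (A - B)"
      using True C
      by (intro saturated_split comp r_pos r_le t) (auto simp: P_def step intro: saturated_mono r_mono)
    then show ?thesis by (auto simp: P_def)
  qed auto
  then obtain \<beta> where \<beta>: "\<And>n A. P n A \<Longrightarrow> \<beta> n A \<subseteq> A \<and> P (Suc n) (\<beta> n A) \<and> P (Suc n) (A - \<beta> n A)"
    by metis

  have "C * r 0 powr t \<le> h"
  proof -
    have "r 0 powr t \<le> ((h / C) powr (1 / t)) powr t"
      using r_0 r_pos[of 0] t by (intro powr_mono2) auto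
    also have "\<dots> = h / C"
      using h C t by (simp add: powr_powr)
    finally show ?thesis
      using C by (simp add: field_simps)
  qed
  then have P0: "P 0 M"
    using h(2) by (auto simp: P_def saturated_space intro: order_trans ennreal_leI)
  have P_branch: "P n (branch \<beta> M w n)" for w n
    by (induction n) (use P0 \<beta> in auto)
  have dec: "branch \<beta> M w (Suc n) \<subseteq> branch \<beta> M w n" for w n
    using \<beta>[OF P_branch[of n w]] by auto
  \<comment> \<open>Nested sets in a compact space: saturation makes them closed, and the positive
    premeasure bound excludes the empty set.\<close>
  have "(\<Inter>n. branch \<beta> M w n) \<noteq> {}" for w
  proof (rule compact_space_imp_nest[OF comp])
    fix n
    show "closedin mtopology (branch \<beta> M w n)"
      using P_branch[of n w] r_pos[of n] closedin_saturated by (auto simp: P_def)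
    show "branch \<beta> M w n \<noteq> {}"
    proof
      assume "branch \<beta> M w n = {}"
      then have "C * r n powr t \<le> 0"
        using P_branch[of n w] by (simp add: P_def ennreal_eq_0_iff)
      moreover have "0 < C * r n powr t"
        using C r_pos[of n] by (intro mult_pos_pos) auto
      ultimately show False by simp
    qed
  qed (intro decseq_SucI dec)
  then have nonempty: "\<exists>x. x \<in> (\<Inter>n. branch \<beta> M w n)" for w
    unfolding ex_in_conv .
  \<comment> \<open>A branch may hold many points. Any of them will do, since the estimate only uses
    membership in the sets along the branch.\<close>
  define \<phi> where "\<phi> w = (SOME x. x \<in> (\<Inter>n. branch \<beta> M w n))" for w
  have "\<phi> w \<in> (\<Inter>n. branch \<beta> M w n)" for w
    unfolding \<phi>_def by (rule someI_ex[OF nonempty])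
  then have \<phi>: "\<phi> w \<in> branch \<beta> M w n" for w n
    unfolding INT_iff by simp
  have \<phi>_M: "\<phi> w \<in> M" for w
    using \<phi>[of w 0] by simp

  have "r 0 * word_dist q a b \<le> d (\<phi> a) (\<phi> b)" if "a \<in> words 2" "b \<in> words 2" for a b
  proof (cases "a = b")
    case True
    then show ?thesis by (simp add: word_dist_def)
  next
    case False
    define l where "l = (LEAST i. a i \<noteq> b i)"
    have "\<exists>i. a i \<noteq> b i"
      using False by auto
    then have "a l \<noteq> b l"
      unfolding l_def by (rule LeastI_ex)
    \<comment> \<open>Both words reach the same node at level \<open>l\<close>, where their
      different letters lead to complementary parts.\<close>
    have "branch \<beta> M a l = branch \<beta> M b l"
      by (rule branch_cong) (use not_less_Least in \<open>auto simp: l_def\<close>)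
    moreover have "a l \<in> {1..2}" "b l \<in> {1..2}"
      using that by (auto simp: words_def)
    then have "a l = 1 \<and> b l = 2 \<or> a l = 2 \<and> b l = 1"
      using \<open>a l \<noteq> b l\<close> by auto
    ultimately have "branch \<beta> M a (Suc l) \<inter> branch \<beta> M b (Suc l) = {}"
      by auto
    then have "\<phi> b \<notin> branch \<beta> M a (Suc l)"
      using \<phi>[of b "Suc l"] by blast
    then have "r (Suc l) \<le> d (\<phi> a) (\<phi> b)"
      using P_branch[of "Suc l" a] \<phi>[of a "Suc l"] \<phi>_M saturated_dist by (auto simp: P_def)
    \<comment> \<open>The exponent in \<open>word_dist\<close> counts letters from 1, which matches
      the level \<open>Suc l\<close> at which the branches separate.\<close>
    moreover have "q powr - real (Suc l) = 1 / q ^ Suc l"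
      using q(1) by (simp only: powr_minus powr_realpow divide_inverse)
    then have "r 0 * word_dist q a b = r (Suc l)"
      using False by (simp add: word_dist_def r_def flip: l_def)
    ultimately show ?thesis by simp
  qed
  then show ?thesis
    using \<phi>_M r_pos[of 0] by (intro bexI[of _ \<phi>] exI[of _ "r 0"]) auto
qed

end

section \<open>The dimension of regular ultrametric spaces\<close>

definition cylinder :: "nat \<Rightarrow> (nat \<Rightarrow> nat) \<Rightarrow> nat \<Rightarrow> (nat \<Rightarrow> nat) set" where
  "cylinder k x n = {y \<in> words k. \<forall>i<n. y i = x i}"

abbreviation uniform_word_measure :: "nat \<Rightarrow> (nat \<Rightarrow> nat) measure" where
  "uniform_word_measure k \<equiv> PiM UNIV (\<lambda>_. uniform_count_measure {1..k})"

lemma space_uniform_word_measure: "space (uniform_word_measure k) = words k"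
  by (auto simp: space_PiM space_uniform_count_measure words_def PiE_def Pi_def)

lemma
  assumes "1 \<le> k" "x \<in> words k"
  shows sets_cylinder: "cylinder k x n \<in> sets (uniform_word_measure k)"
    and emeasure_cylinder: "emeasure (uniform_word_measure k) (cylinder k x n) = ennreal ((1 / real k) ^ n)"
proof -
  let ?N = "\<lambda>_::nat. uniform_count_measure {1..k}"
  let ?A = "\<lambda>i. {x i}"
  have eq: "cylinder k x n = prod_emb UNIV ?N {..<n} (PiE {..<n} ?A)"
    by (auto simp: cylinder_def prod_emb_def space_uniform_count_measure words_def PiE_def Pi_def
        extensional_def)
  have x: "{x i} \<subseteq> {1..k}" for i
    using assms(2) by (auto simp: words_def)
  then have A: "{x i} \<in> sets (?N i)" for i
    by (simp add: sets_uniform_count_measure)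
  then show "cylinder k x n \<in> sets (uniform_word_measure k)"
    unfolding eq by (intro sets_PiM_I) auto
  have "emeasure (uniform_word_measure k) (cylinder k x n) = (\<Prod>i<n. emeasure (?N i) {x i})"
    unfolding eq using assms(1) A
    by (intro emeasure_PiM_emb prob_space_uniform_count_measure) auto
  also have "\<dots> = (\<Prod>i<n. ennreal (1 / real k))"
    by (intro prod.cong refl, subst emeasure_uniform_count_measure) (use x in auto)
  also have "\<dots> = ennreal ((1 / real k) ^ n)"
    by (simp add: prod_constant ennreal_power)
  finally show "emeasure (uniform_word_measure k) (cylinder k x n) = ennreal ((1 / real k) ^ n)" .
qed

text \<open>Words that first differ at an index \<open>i < n\<close> have distance
  \<open>q powr - real (Suc i)\<close>, which is at least \<open>q powr - real n\<close>.\<close>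

lemma word_dist_less_imp_cylinder:
  assumes "1 < q" "y \<in> words k" "word_dist q x y < q powr - real n"
  shows "y \<in> cylinder k x n"
proof -
  have "y i = x i" if "i < n" for i
  proof (rule ccontr)
    assume "y i \<noteq> x i"
    then have "(LEAST i. x i \<noteq> y i) \<le> i"
      by (intro Least_le) auto
    then have "q powr - real n \<le> word_dist q x y"
      using assms(1) that \<open>y i \<noteq> x i\<close> by (auto simp: word_dist_def)
    then show False using assms(3) by simp
  qed
  then show ?thesis using assms(2) by (simp add: cylinder_def)
qed

lemma word_dist_le: "1 < q \<Longrightarrow> word_dist q x y \<le> 1 / q"
proof (cases "x = y")
  case False
  assume "1 < q"
  then have "q powr - real (Suc (LEAST i. x i \<noteq> y i)) \<le> q powr - 1"
    by (intro powr_mono) auto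
  then show ?thesis
    using False \<open>1 < q\<close> by (simp add: word_dist_def powr_minus divide_inverse)
qed (simp add: word_dist_def)

text \<open>The local estimate of the mass distribution principle: for \<open>D > 0\<close>,
  \<open>U\<close> lies in a cylinder whose scale exceeds \<open>D\<close> by a factor of at most
  \<open>q\<close>. As \<open>U\<close> may fail to be measurable, \<open>E\<close> stands in for
  it.\<close>

lemma words_subset_covered:
  assumes k: "1 \<le> k" and q: "1 < q" "q powr s \<le> real k" and s: "0 < s"
    and U: "U \<subseteq> words k" "U \<noteq> {}"
    and D: "\<And>x y. x \<in> U \<Longrightarrow> y \<in> U \<Longrightarrow> word_dist q x y \<le> D" "0 \<le> D" "D < 1"
  shows "\<exists>E\<in>sets (uniform_word_measure k). U \<subseteq> E \<and>
    emeasure (uniform_word_measure k) E \<le> ennreal (q powr s * D powr s)"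
proof -
  let ?\<mu> = "uniform_word_measure k"
  obtain x where x: "x \<in> U" using U(2) by blast
  then have xk: "x \<in> words k" using U(1) by blast
  have sub: "U \<subseteq> cylinder k x n" if "D < q powr - real n" for n
    using D(1)[OF x] that U(1) q(1) by (meson order_le_less_trans subset_iff subsetI word_dist_less_imp_cylinder)
  have pow: "(1 / q powr s) ^ n = (q powr - real n) powr s" for n
  proof -
    have "(1 / q powr s) ^ n = (q powr - s) powr real n"
      using q(1) by (simp add: powr_minus divide_inverse powr_realpow)
    then show ?thesis
      by (simp add: powr_powr mult.commute)
  qed
  have le: "emeasure ?\<mu> (cylinder k x n) \<le> ennreal ((q powr - real n) powr s)" for n
  proof -
    have "(1 / real k) ^ n \<le> (1 / q powr s) ^ n"
      using q k by (intro power_mono divide_left_mono) auto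
    also have "\<dots> = (q powr - real n) powr s"
      by (rule pow)
    finally show ?thesis
      unfolding emeasure_cylinder[OF k xk] by (rule ennreal_leI)
  qed
  show ?thesis
  proof (cases "D = 0")
    case True
    \<comment> \<open>The required bound is 0, while single cylinders have positive mass. Their
      masses tend to 0, so their intersection is null.\<close>
    let ?E = "\<Inter>n. cylinder k x n"
    have E: "?E \<in> sets ?\<mu>"
      using sets_cylinder[OF k xk] by (intro sets.countable_INT) auto
    have "(\<lambda>n. (1 / q powr s) ^ n) \<longlonglongrightarrow> 0"
      using q(1) s by (intro LIMSEQ_power_zero) simp
    then have "(\<lambda>n. (q powr - real n) powr s) \<longlonglongrightarrow> 0"
      by (simp only: pow)
    then have "(\<lambda>n. ennreal ((q powr - real n) powr s)) \<longlonglongrightarrow> ennreal 0"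
      by (rule tendsto_ennrealI)
    moreover have "emeasure ?\<mu> ?E \<le> ennreal ((q powr - real n) powr s)" for n
      using le[of n] sets_cylinder[OF k xk, of n]
      by (meson INT_lower UNIV_I emeasure_mono order_trans)
    ultimately have "emeasure ?\<mu> ?E \<le> ennreal 0"
      by (intro LIMSEQ_le_const) auto
    moreover have "U \<subseteq> ?E"
      using sub True q(1) by auto
    ultimately show ?thesis
      using E by auto
  next
    case False
    have "\<exists>m. (1 / q) ^ m < D"
      using False D(2) q(1) by (intro real_arch_pow_inv) auto
    then have ex: "\<exists>m. q powr - real m \<le> D"
      using q(1) by (auto simp: powr_minus powr_realpow power_inverse divide_inverse intro: less_imp_le)
    \<comment> \<open>As \<open>D < 1\<close>, this \<open>m\<close> is at least 1, and its
      predecessor is the last \<open>n\<close> with \<open>D < q powr - real n\<close>.\<close>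
    define m where "m = (LEAST m. q powr - real m \<le> D)"
    have m: "q powr - real m \<le> D"
      unfolding m_def using ex by (rule LeastI_ex)
    with D(3) q(1) have "m \<noteq> 0"
      by (cases m) auto
    then obtain n where n: "m = Suc n"
      using not0_implies_Suc by blast
    then have lt: "D < q powr - real n"
      using not_less_Least[of n "\<lambda>m. q powr - real m \<le> D"] by (simp add: m_def)
    have "q powr - real n = q * q powr - real m"
      using q(1) by (simp add: n powr_diff powr_minus field_simps flip: powr_add powr_mult_base)
    then have "q powr - real n \<le> q * D"
      using m q(1) by simp
    then have "(q powr - real n) powr s \<le> (q * D) powr s"
      using s by (intro powr_mono2) auto
    also have "\<dots> = q powr s * D powr s"
      using q(1) D(2) by (simp add: powr_mult)
    finally have "emeasure ?\<mu> (cylinder k x n) \<le> ennreal (q powr s * D powr s)"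
      using le[of n] ennreal_leI order_trans by blast
    then show ?thesis
      using sub[OF lt] sets_cylinder[OF k xk] by blast
  qed
qed

text \<open>For \<open>t < s\<close> the sets \<open>E i\<close> cover a space of mass 1, which
  bounds every cover sum below by \<open>q powr - s\<close>. So no such \<open>t\<close> enters the
  infimum.\<close>

theorem hausdorff_dim_words_ge:
  assumes k: "1 \<le> k" and q: "1 < q" "q powr s \<le> real k" and s: "0 < s"
  shows "ereal s \<le> hausdorff_dim (words k) (word_dist q)"
  unfolding hausdorff_dim_def
proof (intro INF_greatest)
  fix t assume "t \<in> {t. 0 \<le> t \<and> hausdorff_measure (words k) (word_dist q) t = 0}"
  then have t: "0 \<le> t" "hausdorff_measure (words k) (word_dist q) t = 0" by auto
  let ?\<mu> = "uniform_word_measure k"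
  interpret prob_space ?\<mu>
    using k by (intro prob_space_PiM prob_space_uniform_count_measure) auto
  show "ereal s \<le> ereal t"
  proof (rule ccontr)
    assume "\<not> ereal s \<le> ereal t"
    then have ts: "t < s" by simp
    have "1 \<le> ennreal (q powr s) * (\<Sum>i. diam_pow (word_dist q) t (U i))"
      if U: "\<And>i. U i \<subseteq> words k" "words k \<subseteq> (\<Union>i. U i)" for U :: "nat \<Rightarrow> _"
    proof -
      have "\<exists>E\<in>sets ?\<mu>. U i \<subseteq> E \<and> emeasure ?\<mu> E \<le> ennreal (q powr s) * diam_pow (word_dist q) t (U i)" for i
      proof (cases "U i = {}")
        case False
        \<comment> \<open>Since \<open>enn2real\<close> sends infinity to 0, \<open>D\<close>
          represents the diameter only once the bound \<open>1 / q\<close> has shown it to be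
          finite.\<close>
        define D where "D = enn2real (ediam (word_dist q) (U i))"
        have "ediam (word_dist q) (U i) \<le> ennreal (1 / q)"
          using word_dist_le[OF q(1)] by (intro ediam_le ennreal_leI)
        then have ed: "ediam (word_dist q) (U i) = ennreal D" and Dq: "D \<le> 1 / q"
          unfolding D_def using q(1) by (auto simp: enn2real_leI top_unique intro!: ennreal_enn2real[symmetric])
            (metis ennreal_less_top order_le_less_trans)
        have D: "0 \<le> D" "D < 1"
          using Dq q(1) by (auto simp: D_def intro: order_le_less_trans)
        have "word_dist q x y \<le> D" if "x \<in> U i" "y \<in> U i" for x y
          using le_ediam[OF that, of "word_dist q"] D(1) by (simp add: ed)
        from words_subset_covered[OF k q s U(1) False this D]
        obtain E where E: "E \<in> sets ?\<mu>" "U i \<subseteq> E" "emeasure ?\<mu> E \<le> ennreal (q powr s * D powr s)"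
          by blast
        \<comment> \<open>As \<open>D < 1\<close>, passing from \<open>s\<close> down to
          \<open>t\<close> does not decrease the power. At \<open>t = 0\<close> the convention
          supplies the value 1.\<close>
        have "ennreal (D powr s) \<le> diam_pow (word_dist q) t (U i)"
        proof (cases "t = 0")
          case True
          then show ?thesis
            using False D s by (simp add: diam_pow_def powr_le1)
        next
          case t_nz: False
          have "D powr s \<le> D powr t"
            using D ts by (cases "D = 0") (auto intro: powr_mono')
          then show ?thesis
            using False t_nz by (simp add: diam_pow_def D_def ennreal_leI)
        qed
        then have "ennreal (q powr s * D powr s) \<le> ennreal (q powr s) * diam_pow (word_dist q) t (U i)"
          by (simp add: ennreal_mult mult_left_mono)
        then show ?thesis using E order_trans by blast
      qed auto
      then obtain E where E: "\<And>i. E i \<in> sets ?\<mu>" "\<And>i. U i \<subseteq> E i"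
        "\<And>i. emeasure ?\<mu> (E i) \<le> ennreal (q powr s) * diam_pow (word_dist q) t (U i)"
        by metis
      have "1 = emeasure ?\<mu> (words k)"
        using emeasure_space_1 unfolding space_uniform_word_measure by (rule sym)
      also have "\<dots> \<le> emeasure ?\<mu> (\<Union>i. E i)"
        using U(2) E(1,2) by (intro emeasure_mono) blast+
      also have "\<dots> \<le> (\<Sum>i. emeasure ?\<mu> (E i))"
        using E(1) by (intro emeasure_subadditive_countably) auto
      also have "\<dots> \<le> (\<Sum>i. ennreal (q powr s) * diam_pow (word_dist q) t (U i))"
        using E(3) by (intro suminf_le) auto
      finally show ?thesis by simp
    qed
    then have "inverse (ennreal (q powr s)) \<le> (\<Sum>i. diam_pow (word_dist q) t (U i))"
      if "\<And>i. U i \<subseteq> words k" "words k \<subseteq> (\<Union>i. U i)" for U :: "nat \<Rightarrow> _"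
      using that divide_le_posI_ennreal[of "ennreal (q powr s)" 1] q(1) by (simp add: divide_ennreal_def)
    then have "inverse (ennreal (q powr s)) \<le> hausdorff_premeasure (words k) (word_dist q) t 1"
      unfolding hausdorff_premeasure_def by (intro INF_greatest) auto
    also have "\<dots> \<le> hausdorff_measure (words k) (word_dist q) t"
      unfolding hausdorff_measure_def by (intro SUP_upper) auto
    finally show False
      using t(2) by simp
  qed
qed

theorem theorem1p8:
  fixes X :: "'a set" and d :: "'a \<Rightarrow> 'a \<Rightarrow> real" and s :: real
  assumes "Ultrametric_space X d"
    and "compact_space (Metric_space.mtopology X d)"
    and "X \<noteq> {}"
    and "ereal s < hausdorff_dim X d"
  shows "\<exists>(k::nat) (q::real). k \<ge> 1 \<and> q > 1 \<and>
           ereal s \<le> hausdorff_dim (words k) (word_dist q) \<and>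
           (\<exists>\<phi> \<in> words k \<rightarrow> X. \<exists>c>0. \<forall>a \<in> words k. \<forall>b \<in> words k.
              d (\<phi> a) (\<phi> b) \<ge> c * word_dist q a b)"
proof -
  interpret Ultrametric_space X d by (rule assms(1))
  show ?thesis
  proof (cases "0 < s")
    case True
    \<comment> \<open>This makes \<open>ln 2 / ln q\<close> equal to \<open>s\<close>. Any
      \<open>t > s\<close> then gives \<open>q powr t > 2\<close>, the strict gain that the tree
      needs.\<close>
    define q :: real where "q = 2 powr (1 / s)"
    have q: "1 < q" "q powr s = 2"
      using True by (simp_all add: q_def powr_powr)
    obtain t where t: "s < t" "ereal t < hausdorff_dim X d"
      using ereal_dense2[OF assms(4)] by auto
    obtain \<delta> where \<delta>: "0 < \<delta>" "0 < hausdorff_premeasure X d t \<delta>"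
      using hausdorff_premeasure_pos_if_less_dim[OF t(2)] t(1) True by (metis less_imp_le order_less_trans)
    have "q powr s < q powr t"
      using q(1) t(1) by simp
    then have "\<exists>\<phi> \<in> words 2 \<rightarrow> X. \<exists>c>0. \<forall>a\<in>words 2. \<forall>b\<in>words 2. c * word_dist q a b \<le> d (\<phi> a) (\<phi> b)"
      using q t(1) True \<delta> by (intro exists_co_lipschitz_from_binary_words assms(2)) auto
    moreover have "ereal s \<le> hausdorff_dim (words 2) (word_dist q)"
      using q True by (intro hausdorff_dim_words_ge) auto
    ultimately show ?thesis
      using q(1) by (intro exI[of _ 2] exI[of _ q]) auto
  next
    case False
    \<comment> \<open>For \<open>s \<le> 0\<close> one letter is enough: there is a single word, so
      a constant map satisfies the estimate.\<close>
    have "0 \<le> hausdorff_dim (words 1) (word_dist 2)"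
      unfolding hausdorff_dim_def by (intro INF_greatest) auto
    then have "ereal s \<le> hausdorff_dim (words 1) (word_dist 2)"
      using False by (simp add: order_trans[of _ 0])
    moreover obtain x where "x \<in> X" using assms(3) by blast
    moreover have "word_dist 2 a b = 0" if "a \<in> words 1" "b \<in> words 1" for a b
      using that by (auto simp: words_def word_dist_def)
    ultimately show ?thesis
      by (intro exI[of _ 1] exI[of _ 2] conjI bexI[of _ "\<lambda>_. x"] exI[of _ "1::real"]) auto
  qed
qed

end
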